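(* Let $n\ge1$ be an integer and let $m=\lfloor n/2\rfloor$. Then $$\mathrm{ord}_2(\mathrm{Com}_n)\ge\left\lceil\frac{n-1}{2}\right\rceil.$$ Equality holds if and only if $\binom{3m}{m}$ is odd, and this happens if and only if the binary expansion of $m$ has no two consecutive unit digits (no two consecutive digits equal to $1$).
   Context: $\mathrm{Com}_n$ is the (integer) coefficient of $x^n$ in $F^{\langle -1\rangle}(x)$, the compositional inverse of the formal power series $F(x)=\sum_{k\ge1}k!\,x^k$. For a prime $p$, $\mathrm{ord}_p(a)$ denotes the largest integer $r$ such that $p^r$ divides $a$. *)

theory Defs
  imports Complex_Main
    "HOL-Library.Extended_Nat"
    "HOL-Computational_Algebra.Primes"
    "HOL-Computational_Algebra.Formal_Power_Series"
begin

unbundle fps_syntax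

definition fact_fps :: "rat fps" where
  "fact_fps = Abs_fps (\<lambda>k. if k = 0 then 0 else fact k)"

text \<open>
  \<^const>\<open>fps_inv\<close> needs coefficients in a field, so the compositional inverse is taken over
  the rationals. The floor only changes the type to \<^typ>\<open>int\<close>, by lemma \<open>of_int_Com\<close> below.
\<close>

definition Com :: "nat \<Rightarrow> int" where
  "Com n = \<lfloor>fps_inv fact_fps $ n\<rfloor>"

lemma fact_fps_nth_0: "fact_fps $ 0 = 0"
  and fact_fps_nth_1: "fact_fps $ 1 = 1"
  by (simp_all add: fact_fps_def)

lemma fact_fps_inverse:
  "fact_fps oo fps_inv fact_fps = fps_X" "fps_inv fact_fps oo fact_fps = fps_X"
  by (rule fps_inv_right fps_inv; simp add: fact_fps_def)+

lemma fact_fps_power_Ints: "(fact_fps ^ i) $ k \<in> \<int>"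
proof (induction i arbitrary: k)
  case 0
  show ?case by simp
next
  case (Suc i)
  have "fact_fps $ j \<in> \<int>" for j
    by (simp add: fact_fps_def fact_in_Ints)
  with Suc show ?case
    by (auto simp: fps_mult_nth intro!: Ints_sum Ints_mult)
qed

lemma of_int_Com: "of_int (Com n) = fps_inv fact_fps $ n"
proof -
  have "compinv fact_fps n \<in> \<int>"
  proof (induction n rule: less_induct)
    case (less n)
    show ?case
    proof (cases n)
      case (Suc k)
      have "(\<Sum>i = 0..k. compinv fact_fps i * (fact_fps ^ i) $ Suc k) \<in> \<int>"
        using less Suc by (intro Ints_sum Ints_mult fact_fps_power_Ints) auto
      with Suc show ?thesis
        by (simp add: fact_fps_nth_1[simplified])
    qed simp
  qed
  then show ?thesis
    by (simp add: Com_def fps_inv_def)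
qed

text \<open>The value at \<open>0\<close>, where \<^const>\<open>multiplicity\<close> is \<open>0\<close> by convention, is \<open>\<infinity>\<close> here.\<close>

definition ordp :: "nat \<Rightarrow> int \<Rightarrow> enat" where
  "ordp p a = (if a = 0 then \<infinity> else enat (multiplicity (int p) a))"

lemma enat_le_ordp_iff:
  assumes "prime p"
  shows "enat r \<le> ordp p a \<longleftrightarrow> int p ^ r dvd a"
proof (cases "a = 0")
  case False
  have "\<not> is_unit (int p)"
    using assms not_prime_1 by auto
  with False show ?thesis
    by (simp add: ordp_def power_dvd_iff_le_multiplicity)
qed (simp add: ordp_def)

end

theory Submission
  imports Defs "HOL-Number_Theory.Cong"
begin

text \<open>
  Write \<open>g\<close> for the coefficients of the compositional inverse \<open>G\<close> of \<open>F\<close>. The factorial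
  recurrence \<open>k! = k (k-1)!\<close> is the differential equation \<open>F = x + x F + x\<^sup>2 F'\<close>; composing it
  with \<open>G\<close> and using \<open>(F' oo G) G' = 1\<close> gives \<open>2 x G' = (1 + x) (G\<^sup>2)' + 2 G\<^sup>2\<close>, an equation that
  is quadratic in \<open>g\<close> (\<open>inv_coeff_recurrence\<close>). In it, put \<open>g (2 m) = 2\<^sup>m E\<^sub>m\<close> and \<open>g (2 m + 1) = 2\<^sup>m O\<^sub>m\<close>, and split the
  convolutions according to the parity of the summation index. The powers of two cancel. In the
  resulting recurrences one term has to be halved, namely \<open>m + 1\<close> times the self-convolution of
  \<open>O\<close> at \<open>m - 1\<close>; for odd \<open>m\<close> the factor \<open>m + 1\<close> is even, and for even \<open>m\<close> the
  self-convolution is, by the symmetry of its summands. So \<open>E\<close> and \<open>O\<close> stay integral (\<open>scaled_Ints\<close>). That is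
  the lower bound on the order, because \<open>\<lceil>(n - 1) / 2\<rceil> = \<lfloor>n / 2\<rfloor>\<close>.

  Modulo 2 most terms of the recurrences cancel as well, again because self-convolutions are even at
  odd indices. What remains is \<open>O\<^sub>m \<equiv> E\<^sub>m \<equiv> W\<^sub>m\<close> for \<open>m \<ge> 1\<close>, where \<open>W\<^sub>m\<close> is the halved term.
  Let \<open>t\<close> be the indicator function of the numbers without two adjacent binary ones, so that
  \<open>t (2 k) = t k\<close>, \<open>t (4 k + 1) = t k\<close> and \<open>t (4 k + 3) = 0\<close>.
  It satisfies the same recurrence modulo 2 (\<open>half_conv_fibbinary_mod_2\<close>); the case of even \<open>m\<close> amounts to
  \<open>T(z) \<equiv> 1 + z T(z) T(z\<^sup>2)\<close>, that is \<open>T \<equiv> 1 + z T\<^sup>3\<close>, for the generating function \<open>T\<close> of \<open>t\<close>.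
  Hence \<open>E\<^sub>m\<close> (for \<open>m \<ge> 1\<close>) and \<open>O\<^sub>m\<close> are odd exactly when \<open>t m = 1\<close>
  (\<open>int_scaled_mod_2\<close>). Finally, the parity of
  \<open>(3 m) choose m\<close> obeys the three rules for \<open>t\<close>, by Lucas' congruence for the prime 2
  (\<open>odd_choose_iff_no_adjacent_ones\<close>).
\<close>

section \<open>Convolutions split by parity\<close>

text \<open>
  This is the coefficient of a product of power series, taken on plain sequences because most
  arguments below are subsequences such as \<open>\<lambda>i. f (2 * i)\<close>.
\<close>

definition conv :: "(nat \<Rightarrow> 'a) \<Rightarrow> (nat \<Rightarrow> 'a) \<Rightarrow> nat \<Rightarrow> 'a::comm_ring_1" where
  "conv f g n = (\<Sum>i\<le>n. f i * g (n - i))"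

lemma fps_mult_nth_conv: "(f * g) $ n = conv (($) f) (($) g) n"
  by (simp add: conv_def fps_mult_nth atLeast0AtMost)

lemma conv_commute: "conv f g n = conv g f n"
  unfolding conv_def
  by (rule sum.reindex_bij_witness[of _ "\<lambda>i. n - i" "\<lambda>i. n - i"]) (auto simp: mult.commute)

lemma of_int_conv: "of_int (conv f g n) = conv (\<lambda>i. of_int (f i)) (\<lambda>i. of_int (g i)) n"
  by (simp add: conv_def)

lemma conv_Ints:
  assumes "\<And>i. i \<le> n \<Longrightarrow> f i \<in> \<int>" "\<And>i. i \<le> n \<Longrightarrow> g i \<in> \<int>"
  shows "conv f g n \<in> \<int>"
  using assms by (auto simp: conv_def intro!: Ints_sum Ints_mult)

lemma conv_cong_mod:
  fixes f g :: "nat \<Rightarrow> int"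
  assumes "\<And>i. i \<le> n \<Longrightarrow> [f i = f' i] (mod k)" "\<And>i. i \<le> n \<Longrightarrow> [g i = g' i] (mod k)"
  shows "[conv f g n = conv f' g' n] (mod k)"
  unfolding conv_def using assms by (intro cong_sum cong_mult) auto

lemma sum_atMost_even_split:
  fixes f :: "nat \<Rightarrow> 'a::comm_monoid_add"
  shows "(\<Sum>i\<le>2 * n. f i) = (\<Sum>i\<le>n. f (2 * i)) + (\<Sum>i<n. f (2 * i + 1))"
  by (induction n) (simp_all add: add_ac)

lemma sum_atMost_odd_split:
  fixes f :: "nat \<Rightarrow> 'a::comm_monoid_add"
  shows "(\<Sum>i\<le>2 * n + 1. f i) = (\<Sum>i\<le>n. f (2 * i)) + (\<Sum>i\<le>n. f (2 * i + 1))"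
  by (induction n) (simp_all add: add_ac)

lemma conv_odd_split:
  "conv f g (2 * n + 1) =
    conv (\<lambda>i. f (2 * i)) (\<lambda>i. g (2 * i + 1)) n + conv (\<lambda>i. f (2 * i + 1)) (\<lambda>i. g (2 * i)) n"
proof -
  have "2 * n + 1 - 2 * i = 2 * (n - i) + 1" "2 * n + 1 - (2 * i + 1) = 2 * (n - i)"
    if "i \<le> n" for i
    using that by auto
  then show ?thesis
    unfolding conv_def sum_atMost_odd_split
    by (intro arg_cong2[where f = "(+)"] sum.cong) auto
qed

lemma conv_even_split:
  "conv f g (2 * n + 2) =
    conv (\<lambda>i. f (2 * i)) (\<lambda>i. g (2 * i)) (n + 1) + conv (\<lambda>i. f (2 * i + 1)) (\<lambda>i. g (2 * i + 1)) n"
proof -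
  have "2 * (n + 1) - 2 * i = 2 * (n + 1 - i)" for i
    by auto
  moreover have "2 * (n + 1) - (2 * i + 1) = 2 * (n - i) + 1" if "i < n + 1" for i
    using that by auto
  ultimately have "conv f g (2 * (n + 1)) = (\<Sum>i\<le>n + 1. f (2 * i) * g (2 * (n + 1 - i))) +
      (\<Sum>i<n + 1. f (2 * i + 1) * g (2 * (n - i) + 1))"
    unfolding conv_def sum_atMost_even_split
    by (intro arg_cong2[where f = "(+)"] sum.cong) simp_all
  then show ?thesis
    by (simp add: conv_def lessThan_Suc_atMost)
qed

lemma conv_self_odd:
  "conv f f (2 * n + 1) = 2 * conv (\<lambda>i. f (2 * i)) (\<lambda>i. f (2 * i + 1)) n"
  unfolding conv_odd_split by (subst (2) conv_commute) simp

text \<open>Modulo 2, squaring a power series \<open>f(z)\<close> gives \<open>f(z\<^sup>2)\<close>.\<close>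

lemma conv_self_even_mod_2:
  fixes f :: "nat \<Rightarrow> int"
  shows "[conv f f (2 * n) = f n] (mod 2)"
proof -
  have "(\<Sum>i\<in>{n<..2 * n}. f i * f (2 * n - i)) = (\<Sum>i<n. f i * f (2 * n - i))"
    by (rule sum.reindex_bij_witness[of _ "\<lambda>i. 2 * n - i" "\<lambda>i. 2 * n - i"]) auto
  moreover have "conv f f (2 * n) = (\<Sum>i<n. f i * f (2 * n - i)) +
      (f n * f n + (\<Sum>i\<in>{n<..2 * n}. f i * f (2 * n - i)))"
  proof -
    have "{..2 * n} = {..<n} \<union> insert n {n<..2 * n}"
      by auto
    moreover have "{..<n} \<inter> insert n {n<..2 * n} = {}"
      by auto
    ultimately show ?thesis
      by (simp add: conv_def sum.union_disjoint del: Un_insert_right)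
  qed
  ultimately have "conv f f (2 * n) = f n * f n + 2 * (\<Sum>i<n. f i * f (2 * n - i))"
    by simp
  then show ?thesis
    by (auto simp: cong_iff_dvd_diff)
qed

section \<open>Numbers without adjacent binary ones\<close>

definition no_adjacent_ones :: "nat \<Rightarrow> bool" where
  "no_adjacent_ones m \<longleftrightarrow> \<not> (\<exists>i. bit m i \<and> bit m (Suc i))"

lemma no_adjacent_ones_0: "no_adjacent_ones 0"
  by (simp add: no_adjacent_ones_def)

lemma no_adjacent_ones_rec:
  "no_adjacent_ones m \<longleftrightarrow> \<not> (odd m \<and> odd (m div 2)) \<and> no_adjacent_ones (m div 2)"
proof -
  have "(\<exists>i. bit m i \<and> bit m (Suc i)) \<longleftrightarrow>
      (bit m 0 \<and> bit m (Suc 0)) \<or> (\<exists>i. bit m (Suc i) \<and> bit m (Suc (Suc i)))"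
    by (metis not0_implies_Suc)
  then show ?thesis
    by (simp add: no_adjacent_ones_def bit_Suc bit_0)
qed

lemma no_adjacent_ones_even: "no_adjacent_ones (2 * k) = no_adjacent_ones k"
  by (subst no_adjacent_ones_rec) simp

lemma no_adjacent_ones_1_mod_4: "no_adjacent_ones (2 * (2 * k) + 1) = no_adjacent_ones k"
  by (subst no_adjacent_ones_rec) (simp add: no_adjacent_ones_even)

lemma no_adjacent_ones_3_mod_4: "\<not> no_adjacent_ones (2 * (2 * k + 1) + 1)"
  by (subst no_adjacent_ones_rec) simp

lemma nat_mod_4_induct [case_names zero even one three]:
  assumes "P 0" "\<And>k. k > 0 \<Longrightarrow> P k \<Longrightarrow> P (2 * k)"
    "\<And>k. P k \<Longrightarrow> P (2 * (2 * k) + 1)" "\<And>k. P (2 * (2 * k + 1) + 1)"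
  shows "P (m::nat)"
proof (induction m rule: less_induct)
  case (less m)
  have "m = 0 \<or> (\<exists>k>0. m = 2 * k) \<or> (\<exists>k. m = 2 * (2 * k) + 1) \<or> (\<exists>k. m = 2 * (2 * k + 1) + 1)"
    by presburger
  then consider "m = 0" | k where "m = 2 * k" "k > 0"
    | k where "m = 2 * (2 * k) + 1" | k where "m = 2 * (2 * k + 1) + 1"
    by blast
  then show ?case
    by cases (use assms less in auto)
qed

lemma even_double_choose_odd: "even ((2 * n) choose (2 * k + 1))"
proof (induction n arbitrary: k)
  case (Suc n)
  show ?case
  proof (cases k)
    case (Suc j)
    then show ?thesis
      using Suc.IH[of j] Suc.IH[of "j + 1"] by simp
  qed simp
qed simp

lemma odd_double_choose_double: "odd ((2 * n) choose (2 * k)) \<longleftrightarrow> odd (n choose k)"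
proof (induction n arbitrary: k)
  case 0
  show ?case by (cases k) auto
next
  case (Suc n)
  show ?case
  proof (cases k)
    case (Suc j)
    then show ?thesis
      using Suc.IH[of j] Suc.IH[of "j + 1"] even_double_choose_odd[of n j] by simp
  qed simp
qed

lemma odd_Suc_double_choose_double: "odd ((2 * n + 1) choose (2 * k)) \<longleftrightarrow> odd (n choose k)"
proof (cases k)
  case (Suc j)
  then show ?thesis
    using even_double_choose_odd[of n j] odd_double_choose_double[of n k] by simp
qed simp

lemma odd_Suc_double_choose_Suc_double:
  "odd ((2 * n + 1) choose (2 * k + 1)) \<longleftrightarrow> odd (n choose k)"
  using even_double_choose_odd[of n k] odd_double_choose_double[of n k] by simp

text \<open>
  By Lucas, the binomial coefficient is odd iff every binary one of \<open>m\<close> is also one of \<open>3 m\<close>. Low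
  digits that match can be stripped: \<open>0\<close> over \<open>0\<close> if \<open>m = 2 k\<close>, and \<open>11\<close> over \<open>01\<close> if
  \<open>m = 4 k + 1\<close>. If \<open>m = 4 k + 3\<close>, then \<open>3 m\<close> ends in \<open>01\<close> and misses a one of \<open>m\<close>.
\<close>

theorem odd_choose_iff_no_adjacent_ones: "odd ((3 * m) choose m) \<longleftrightarrow> no_adjacent_ones m"
proof (induction m rule: nat_mod_4_induct)
  case zero
  show ?case by (simp add: no_adjacent_ones_0)
next
  case (even k)
  then show ?case
    using odd_double_choose_double[of "3 * k" k] by (simp add: no_adjacent_ones_even)
next
  case (one k)
  have "3 * (2 * (2 * k) + 1) = 2 * (2 * (3 * k) + 1) + 1" by simp
  then show ?case
    using one by (simp only: no_adjacent_ones_1_mod_4 odd_Suc_double_choose_Suc_double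
        odd_Suc_double_choose_double)
next
  case (three k)
  have "3 * (2 * (2 * k + 1) + 1) = 2 * (2 * (3 * k + 2)) + 1" by simp
  then show ?case
    using even_double_choose_odd[of "3 * k + 2" k]
    by (simp only: no_adjacent_ones_3_mod_4 odd_Suc_double_choose_Suc_double) simp
qed

text \<open>The numbers without adjacent binary ones are also called fibbinary numbers.\<close>

definition fibbinary :: "nat \<Rightarrow> int" where
  "fibbinary m = of_bool (no_adjacent_ones m)"

lemma fibbinary_0: "fibbinary 0 = 1"
  by (simp add: fibbinary_def no_adjacent_ones_0)

lemma odd_fibbinary_iff: "odd (fibbinary m) \<longleftrightarrow> no_adjacent_ones m"
  by (simp add: fibbinary_def)

lemma fibbinary_even: "fibbinary (2 * k) = fibbinary k"
  and fibbinary_1_mod_4: "fibbinary (2 * (2 * k) + 1) = fibbinary k"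
  and fibbinary_3_mod_4: "fibbinary (2 * (2 * k + 1) + 1) = 0"
  using no_adjacent_ones_even[of k] no_adjacent_ones_1_mod_4[of k] no_adjacent_ones_3_mod_4[of k]
  by (simp_all only: fibbinary_def of_bool_eq)

text \<open>
  This is \<open>T(z) \<equiv> 1 + z T(z) T(z\<^sup>2)\<close> for the generating function \<open>T\<close> of \<open>fibbinary\<close>: the sequence
  \<open>fibbinary (2 i + 1)\<close> is \<open>fibbinary\<close> spread out over the even indices.
  Splitting the convolution by parity leads back to a self-convolution when \<open>k\<close> is even, and to the claim at \<open>k div 2\<close> when \<open>k\<close> is odd.
\<close>

lemma fibbinary_conv_mod_2:
  "[conv fibbinary (\<lambda>i. fibbinary (2 * i + 1)) k = fibbinary (k + 1)] (mod 2)"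
proof (induction k rule: less_induct)
  case (less k)
  have "k = 0 \<or> (\<exists>l. k = 2 * l + 2) \<or> (\<exists>l. k = 2 * l + 1)"
    by presburger
  then consider "k = 0" | l where "k = 2 * l + 2" | l where "k = 2 * l + 1"
    by blast
  then show ?case
  proof cases
    case 1
    then show ?thesis
      using fibbinary_1_mod_4[of 0] by (simp add: conv_def fibbinary_0)
  next
    case 2
    have "conv fibbinary (\<lambda>i. fibbinary (2 * i + 1)) k = conv fibbinary fibbinary (l + 1)"
      unfolding 2 conv_even_split fibbinary_even fibbinary_1_mod_4 fibbinary_3_mod_4
      by (simp add: conv_def)
    also have "[\<dots> = fibbinary (2 * (l + 1) + 1)] (mod 2)"
    proof (cases "even (l + 1)")
      case True
      then obtain j where "l + 1 = 2 * j" by blast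
      then show ?thesis
        using conv_self_even_mod_2[of fibbinary j] fibbinary_1_mod_4[of j] by simp
    next
      case False
      then obtain j where j: "l + 1 = 2 * j + 1" by (rule oddE)
      show ?thesis
        unfolding j conv_self_odd fibbinary_3_mod_4 by (simp add: cong_0_iff)
    qed
    finally show ?thesis
      by (simp add: 2)
  next
    case 3
    have "conv fibbinary (\<lambda>i. fibbinary (2 * i + 1)) k = conv fibbinary (\<lambda>i. fibbinary (2 * i + 1)) l"
      unfolding 3 conv_odd_split fibbinary_even fibbinary_1_mod_4 fibbinary_3_mod_4
      by (subst (2) conv_commute) (simp add: conv_def)
    also have "[\<dots> = fibbinary (l + 1)] (mod 2)"
      using less 3 by simp
    finally show ?thesis
      using fibbinary_even[of "l + 1"] 3 by simp
  qed
qed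

section \<open>The quadratic recurrence\<close>

abbreviation inv_coeff :: "nat \<Rightarrow> rat" where
  "inv_coeff n \<equiv> fps_inv fact_fps $ n"

lemma fact_fps_ODE:
  "fact_fps = fps_X + fps_X * fact_fps + fps_X\<^sup>2 * fps_deriv fact_fps"
proof (rule fps_ext)
  fix n
  show "fact_fps $ n = (fps_X + fps_X * fact_fps + fps_X\<^sup>2 * fps_deriv fact_fps) $ n"
  proof (cases n)
    case 0
    then show ?thesis by (simp add: fact_fps_def power2_eq_square mult.assoc)
  next
    case (Suc k)
    then show ?thesis
      by (cases k) (auto simp: fact_fps_def power2_eq_square mult.assoc algebra_simps)
  qed
qed

lemma fps_inv_fact_fps_ODE:
  defines "G \<equiv> fps_inv fact_fps"
  shows "fps_const 2 * (fps_X * fps_deriv G) =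
    (1 + fps_X) * fps_deriv (G * G) + fps_const 2 * (G * G)"
proof -
  have G0: "G $ 0 = 0"
    by (simp add: G_def fps_inv_def)
  have FG: "fact_fps oo G = fps_X"
    unfolding G_def by (rule fact_fps_inverse)
  have chain: "(fps_deriv fact_fps oo G) * fps_deriv G = 1"
    using fps_compose_deriv[OF G0, of fact_fps] by (simp add: FG)
  have "fps_X = (fps_X + fps_X * fact_fps + fps_X\<^sup>2 * fps_deriv fact_fps) oo G"
    using FG fact_fps_ODE by simp
  also have "\<dots> = G + G * fps_X + G * G * (fps_deriv fact_fps oo G)"
    using G0 by (simp add: fps_compose_add_distrib fps_compose_mult_distrib power2_eq_square FG)
  finally have eq: "fps_X = G + G * fps_X + G * G * (fps_deriv fact_fps oo G)" .
  have "fps_X * fps_deriv G = (G + G * fps_X + G * G * (fps_deriv fact_fps oo G)) * fps_deriv G"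
    by (subst eq) simp
  also have "\<dots> = (1 + fps_X) * G * fps_deriv G + G * G * ((fps_deriv fact_fps oo G) * fps_deriv G)"
    by (simp add: algebra_simps)
  finally have "fps_X * fps_deriv G = (1 + fps_X) * G * fps_deriv G + G * G"
    unfolding chain by simp
  then show ?thesis
    by (simp add: algebra_simps flip: numeral_fps_const)
qed

text \<open>Doubling the equation makes \<open>2 G G'\<close> the derivative of \<open>G\<^sup>2\<close>, so only \<open>G\<^sup>2\<close> is nonlinear.\<close>

lemma inv_coeff_recurrence:
  "2 * of_nat n * inv_coeff n =
    of_nat (n + 2) * conv inv_coeff inv_coeff n + of_nat (n + 1) * conv inv_coeff inv_coeff (n + 1)"
proof -
  let ?G = "fps_inv fact_fps"
  have "(fps_const 2 * (fps_X * fps_deriv ?G)) $ n =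
      ((1 + fps_X) * fps_deriv (?G * ?G) + fps_const 2 * (?G * ?G)) $ n"
    by (simp only: fps_inv_fact_fps_ODE)
  then show ?thesis
    unfolding distrib_right fps_add_nth fps_mult_left_const_nth fps_mult_nth_conv[symmetric]
    by (cases n) (simp_all add: algebra_simps del: fps_deriv_mult)
qed

section \<open>Scaling by powers of two\<close>

definition scaled_even :: "nat \<Rightarrow> rat" where
  "scaled_even m = inv_coeff (2 * m) / 2 ^ m"

definition scaled_odd :: "nat \<Rightarrow> rat" where
  "scaled_odd m = inv_coeff (2 * m + 1) / 2 ^ m"

lemma scaled_even_0: "scaled_even 0 = 0"
  by (simp add: scaled_even_def fps_inv_def)

lemma scaled_odd_0: "scaled_odd 0 = 1"
  by (simp add: scaled_odd_def fps_inv_def fact_fps_def)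

lemma conv_power_scale:
  "conv (\<lambda>i. c ^ i * f i) (\<lambda>i. c ^ i * g i) n = c ^ n * conv f g n"
  unfolding conv_def sum_distrib_left
proof (rule sum.cong)
  fix i
  assume "i \<in> {..n}"
  then have "c ^ n = c ^ i * c ^ (n - i)"
    by (simp flip: power_add)
  then show "c ^ i * f i * (c ^ (n - i) * g (n - i)) = c ^ n * (f i * g (n - i))"
    by (simp add: mult_ac)
qed simp

lemma inv_coeff_even: "inv_coeff (2 * m) = 2 ^ m * scaled_even m"
  and inv_coeff_odd: "inv_coeff (2 * m + 1) = 2 ^ m * scaled_odd m"
  by (simp_all add: scaled_even_def scaled_odd_def)

lemma conv_inv_coeff_odd:
  "conv inv_coeff inv_coeff (2 * m + 1) = 2 * 2 ^ m * conv scaled_even scaled_odd m"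
  unfolding conv_self_odd inv_coeff_even inv_coeff_odd conv_power_scale by simp

lemma conv_inv_coeff_even:
  "conv inv_coeff inv_coeff (2 * m + 2) =
    2 ^ m * (2 * conv scaled_even scaled_even (m + 1) + conv scaled_odd scaled_odd m)"
  unfolding conv_even_split inv_coeff_even inv_coeff_odd conv_power_scale
  by (simp add: algebra_simps)

lemma scaled_even_recurrence:
  "4 * of_nat (m + 1) * scaled_even (m + 1) =
    2 * of_nat (m + 2) * conv scaled_even scaled_even (m + 1) +
    of_nat (m + 2) * conv scaled_odd scaled_odd m +
    2 * of_nat (2 * m + 3) * conv scaled_even scaled_odd (m + 1)"
proof -
  have "2 ^ (m + 1) * (4 * of_nat (m + 1) * scaled_even (m + 1)) =
    2 ^ (m + 1) * (2 * of_nat (m + 2) * conv scaled_even scaled_even (m + 1)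
      + of_nat (m + 2) * conv scaled_odd scaled_odd m
      + 2 * of_nat (2 * m + 3) * conv scaled_even scaled_odd (m + 1))"
    using inv_coeff_recurrence[of "2 * (m + 1)"] conv_inv_coeff_even[of m]
      conv_inv_coeff_odd[of "m + 1"] inv_coeff_even[of "m + 1"]
    by (simp add: algebra_simps)
  then show ?thesis
    by (simp only: mult_cancel_left) simp
qed

lemma scaled_odd_recurrence:
  "of_nat (2 * m + 1) * scaled_odd m =
    of_nat (2 * m + 3) * conv scaled_even scaled_odd m +
    of_nat (m + 1) * (2 * conv scaled_even scaled_even (m + 1) + conv scaled_odd scaled_odd m)"
proof -
  have "(2 * 2 ^ m) * (of_nat (2 * m + 1) * scaled_odd m) =
    (2 * 2 ^ m) * (of_nat (2 * m + 3) * conv scaled_even scaled_odd m +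
      of_nat (m + 1) * (2 * conv scaled_even scaled_even (m + 1) + conv scaled_odd scaled_odd m))"
    using inv_coeff_recurrence[of "2 * m + 1"] conv_inv_coeff_even[of m]
      conv_inv_coeff_odd[of m] inv_coeff_odd[of m]
    by (simp add: algebra_simps)
  then show ?thesis
    by (simp only: mult_cancel_left) simp
qed

text \<open>
  The index \<open>m + 1\<close> enters a convolution at \<open>m + 1\<close> only through its two end terms. Separating them
  from the sum over the indices strictly between turns the two implicit recurrences into explicit
  ones. It also leaves only indices \<open>\<ge> 1\<close>, for which both scaled sequences agree modulo 2.
\<close>

definition inner_conv :: "(nat \<Rightarrow> 'a) \<Rightarrow> (nat \<Rightarrow> 'a) \<Rightarrow> nat \<Rightarrow> 'a::comm_ring_1" where
  "inner_conv f g m = (\<Sum>i<m. f (Suc i) * g (m - i))"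

lemma conv_eq_inner_conv:
  "conv f g (m + 1) = f 0 * g (m + 1) + inner_conv f g m + f (m + 1) * g 0"
proof -
  have "conv f g (m + 1) = (\<Sum>i<Suc m. f i * g (Suc m - i)) + f (Suc m) * g 0"
    by (simp add: conv_def lessThan_Suc_atMost)
  then show ?thesis
    unfolding sum.lessThan_Suc_shift by (simp add: inner_conv_def)
qed

lemma inner_conv_Ints:
  assumes "\<And>i. i \<le> m \<Longrightarrow> f i \<in> \<int>" "\<And>i. i \<le> m \<Longrightarrow> g i \<in> \<int>"
  shows "inner_conv f g m \<in> \<int>"
  using assms by (auto simp: inner_conv_def intro!: Ints_sum Ints_mult)

lemma of_int_inner_conv:
  "of_int (inner_conv f g m) = inner_conv (\<lambda>i. of_int (f i)) (\<lambda>i. of_int (g i)) m"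
  by (simp add: inner_conv_def)

lemma inner_conv_cong_mod:
  fixes f g :: "nat \<Rightarrow> int"
  assumes "\<And>i. 1 \<le> i \<Longrightarrow> i \<le> m \<Longrightarrow> [f i = f' i] (mod k)"
    "\<And>i. 1 \<le> i \<Longrightarrow> i \<le> m \<Longrightarrow> [g i = g' i] (mod k)"
  shows "[inner_conv f g m = inner_conv f' g' m] (mod k)"
  unfolding inner_conv_def using assms by (intro cong_sum cong_mult) auto

text \<open>
  Half of \<open>(k + 2) * conv f f k\<close>, written without division: for even \<open>k\<close> the factor \<open>k + 2\<close> is
  halved, for odd \<open>k\<close> the self-convolution.
\<close>

definition half_conv :: "(nat \<Rightarrow> 'a) \<Rightarrow> nat \<Rightarrow> 'a::comm_ring_1" where
  "half_conv f k = (if even k then of_nat (k div 2 + 1) * conv f f k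
    else of_nat (k + 2) * conv (\<lambda>i. f (2 * i)) (\<lambda>i. f (2 * i + 1)) (k div 2))"

lemma half_conv_even: "half_conv f (2 * j) = of_nat (j + 1) * conv f f (2 * j)"
  and half_conv_odd: "half_conv f (2 * j + 1) =
    of_nat (2 * j + 3) * conv (\<lambda>i. f (2 * i)) (\<lambda>i. f (2 * i + 1)) j"
  by (simp_all add: half_conv_def add.commute)

lemma two_half_conv: "of_nat (k + 2) * conv f f k = 2 * half_conv f k"
proof (cases "even k")
  case True
  then obtain j where j: "k = 2 * j" by blast
  show ?thesis
    unfolding j half_conv_even by (simp add: algebra_simps)
next
  case False
  then obtain j where j: "k = 2 * j + 1" by (rule oddE)
  show ?thesis
    unfolding j half_conv_odd conv_self_odd by (simp add: algebra_simps)
qed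

lemma half_conv_Ints:
  assumes "\<And>i. i \<le> k \<Longrightarrow> f i \<in> \<int>"
  shows "half_conv f k \<in> \<int>"
  unfolding half_conv_def using assms by (auto intro!: Ints_mult conv_Ints Ints_of_nat elim!: oddE)

lemma of_int_half_conv: "of_int (half_conv f k) = half_conv (\<lambda>i. of_int (f i)) k"
  by (simp add: half_conv_def of_int_conv)

lemma half_conv_cong_mod:
  fixes f :: "nat \<Rightarrow> int"
  assumes "\<And>i. i \<le> k \<Longrightarrow> [f i = g i] (mod n)"
  shows "[half_conv f k = half_conv g k] (mod n)"
  unfolding half_conv_def using assms
  by (auto intro!: cong_mult conv_cong_mod elim!: oddE)

text \<open>
  Solved for the newest term, both recurrences have leading coefficient \<open>-1\<close>: the term occurs on
  both sides, with coefficients \<open>4 k + 4\<close> and \<open>4 k + 6\<close> for \<open>scaled_even\<close>, where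
  \<open>two_half_conv\<close> allows the whole equation to be halved, and with coefficients \<open>2 k + 3\<close> and
  \<open>2 k + 4\<close> for \<open>scaled_odd\<close>. Hence integrality propagates.
\<close>

lemma scaled_even_Suc:
  "- scaled_even (k + 1) = of_nat (k + 2) * inner_conv scaled_even scaled_even k +
    half_conv scaled_odd k +
    of_nat (2 * k + 3) * inner_conv scaled_even scaled_odd k"
  using scaled_even_recurrence[of k] unfolding two_half_conv conv_eq_inner_conv
  by (simp add: scaled_even_0 scaled_odd_0 algebra_simps)

lemma scaled_odd_Suc:
  "- scaled_odd (k + 1) =
    of_nat (2 * k + 5) * (inner_conv scaled_even scaled_odd k + scaled_even (k + 1)) +
    of_nat (k + 2) * (2 * inner_conv scaled_even scaled_even (k + 1) +
      inner_conv scaled_odd scaled_odd k)"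
  using scaled_odd_recurrence[of "k + 1"] unfolding conv_eq_inner_conv
  by (simp add: scaled_even_0 scaled_odd_0 algebra_simps)

lemma scaled_Ints: "scaled_even m \<in> \<int> \<and> scaled_odd m \<in> \<int>"
proof (induction m rule: less_induct)
  case (less m)
  show ?case
  proof (cases m)
    case 0
    then show ?thesis by (simp add: scaled_even_0 scaled_odd_0)
  next
    case (Suc k)
    have int: "scaled_even i \<in> \<int>" "scaled_odd i \<in> \<int>" if "i \<le> k" for i
      using less that Suc by auto
    have "- scaled_even (k + 1) \<in> \<int>"
      unfolding scaled_even_Suc
      by (intro Ints_add Ints_mult Ints_of_nat inner_conv_Ints half_conv_Ints int)
    then have even: "scaled_even (k + 1) \<in> \<int>"
      by (simp only: minus_in_Ints_iff)
    then have int': "scaled_even i \<in> \<int>" if "i \<le> k + 1" for i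
      using int(1)[of i] that by (cases "i = k + 1") auto
    have "- scaled_odd (k + 1) \<in> \<int>"
      unfolding scaled_odd_Suc
      by (intro Ints_add Ints_mult Ints_of_nat Ints_numeral inner_conv_Ints int int' even)
    with even Suc show ?thesis
      by (simp only: minus_in_Ints_iff Suc_eq_plus1)
  qed
qed

definition int_scaled_even :: "nat \<Rightarrow> int" where
  "int_scaled_even m = \<lfloor>scaled_even m\<rfloor>"

definition int_scaled_odd :: "nat \<Rightarrow> int" where
  "int_scaled_odd m = \<lfloor>scaled_odd m\<rfloor>"

lemma of_int_int_scaled_even: "of_int (int_scaled_even m) = scaled_even m"
  and of_int_int_scaled_odd: "of_int (int_scaled_odd m) = scaled_odd m"
  using scaled_Ints[of m] by (auto simp: int_scaled_even_def int_scaled_odd_def elim!: Ints_cases)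

lemma Com_even: "Com (2 * m) = 2 ^ m * int_scaled_even m"
  and Com_odd: "Com (2 * m + 1) = 2 ^ m * int_scaled_odd m"
proof -
  have "(of_int (Com (2 * m)) :: rat) = of_int (2 ^ m * int_scaled_even m)"
    unfolding of_int_Com inv_coeff_even by (simp add: of_int_int_scaled_even)
  then show "Com (2 * m) = 2 ^ m * int_scaled_even m"
    by (simp only: of_int_eq_iff)
  have "(of_int (Com (2 * m + 1)) :: rat) = of_int (2 ^ m * int_scaled_odd m)"
    unfolding of_int_Com inv_coeff_odd by (simp add: of_int_int_scaled_odd)
  then show "Com (2 * m + 1) = 2 ^ m * int_scaled_odd m"
    by (simp only: of_int_eq_iff)
qed

lemma int_scaled_even_Suc:
  "- int_scaled_even (k + 1) = int (k + 2) * inner_conv int_scaled_even int_scaled_even k +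
    half_conv int_scaled_odd k +
    int (2 * k + 3) * inner_conv int_scaled_even int_scaled_odd k"
  using scaled_even_Suc[of k] unfolding of_int_eq_iff[where 'a = rat, symmetric]
  by (simp only: of_int_add of_int_mult of_int_minus of_int_of_nat_eq of_int_inner_conv
      of_int_half_conv of_int_int_scaled_even of_int_int_scaled_odd)

lemma int_scaled_odd_Suc:
  "- int_scaled_odd (k + 1) =
    int (2 * k + 5) * (inner_conv int_scaled_even int_scaled_odd k + int_scaled_even (k + 1)) +
    int (k + 2) * (2 * inner_conv int_scaled_even int_scaled_even (k + 1) +
      inner_conv int_scaled_odd int_scaled_odd k)"
  using scaled_odd_Suc[of k] unfolding of_int_eq_iff[where 'a = rat, symmetric]
  by (simp only: of_int_add of_int_mult of_int_minus of_int_of_nat_eq of_int_inner_conv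
      of_int_numeral of_int_half_conv of_int_int_scaled_even of_int_int_scaled_odd)

section \<open>Parity of the scaled coefficients\<close>

text \<open>
  This is \<open>t m \<equiv> W\<^sub>m\<close> at \<open>m = k + 1\<close>, with \<open>t\<close> in place of \<open>O\<close>. For even \<open>k = 2 j\<close> the factor
  \<open>j + 1\<close> tells apart the two residues of \<open>m = 2 j + 1\<close> modulo 4; odd \<open>k\<close>
  reduces to \<open>fibbinary_conv_mod_2\<close>.
\<close>

lemma half_conv_fibbinary_mod_2: "[half_conv fibbinary k = fibbinary (k + 1)] (mod 2)"
proof (cases "even k")
  case True
  then obtain j where j: "k = 2 * j" by blast
  have "[half_conv fibbinary k = int (j + 1) * fibbinary j] (mod 2)"
    unfolding j half_conv_even by (intro cong_mult cong_refl conv_self_even_mod_2)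
  also have "[int (j + 1) * fibbinary j = fibbinary (2 * j + 1)] (mod 2)"
  proof (cases "even j")
    case True
    then obtain l where l: "j = 2 * l" by blast
    show ?thesis
      unfolding l fibbinary_even fibbinary_1_mod_4 by (simp add: cong_iff_dvd_diff algebra_simps)
  next
    case False
    then obtain l where l: "j = 2 * l + 1" by (rule oddE)
    show ?thesis
      unfolding l fibbinary_3_mod_4 by (simp add: cong_0_iff)
  qed
  finally show ?thesis
    by (simp add: j)
next
  case False
  then obtain j where j: "k = 2 * j + 1" by (rule oddE)
  have "[half_conv fibbinary k = 1 * fibbinary (j + 1)] (mod 2)"
    unfolding j half_conv_odd fibbinary_even
    by (intro cong_mult fibbinary_conv_mod_2) (simp add: cong_iff_dvd_diff)
  then show ?thesis
    using fibbinary_even[of "j + 1"] by (simp add: j)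
qed

lemma int_scaled_mod_2:
  "[int_scaled_odd m = fibbinary m] (mod 2) \<and> (m \<ge> 1 \<longrightarrow> [int_scaled_even m = fibbinary m] (mod 2))"
proof (induction m rule: less_induct)
  case (less m)
  show ?case
  proof (cases m)
    case 0
    then show ?thesis by (simp add: int_scaled_odd_def scaled_odd_0 fibbinary_0)
  next
    case (Suc k)
    define S where "S = inner_conv fibbinary fibbinary k"
    have IH: "[int_scaled_odd i = fibbinary i] (mod 2)"
      "i \<ge> 1 \<Longrightarrow> [int_scaled_even i = fibbinary i] (mod 2)"
      if "i \<le> k" for i
      using less that Suc by auto
    have S: "[inner_conv int_scaled_even int_scaled_even k = S] (mod 2)"
      "[inner_conv int_scaled_even int_scaled_odd k = S] (mod 2)"
      "[inner_conv int_scaled_odd int_scaled_odd k = S] (mod 2)"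
      unfolding S_def by (intro inner_conv_cong_mod IH; assumption)+
    have half: "[half_conv int_scaled_odd k = fibbinary (k + 1)] (mod 2)"
      by (rule cong_trans[OF half_conv_cong_mod half_conv_fibbinary_mod_2]) (rule IH)
    \<comment> \<open>Both recurrences reduce modulo 2 to the value sought plus \<open>(k + 1) S\<close>, so \<open>S\<close> matters only
      when \<open>k\<close> is even; then it is, up to an even end term, a self-convolution at an odd index.\<close>
    have even: "even S" if "even k"
    proof -
      obtain j where j: "k = 2 * j"
        using \<open>even k\<close> by (rule evenE)
      have "even (conv fibbinary fibbinary (k + 1))"
        unfolding j conv_self_odd by simp
      then show ?thesis
        unfolding conv_eq_inner_conv S_def[symmetric] by (simp add: fibbinary_0)
    qed
    have *: "even (inner_conv int_scaled_even int_scaled_even k) = even S"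
      "even (inner_conv int_scaled_even int_scaled_odd k) = even S"
      "even (inner_conv int_scaled_odd int_scaled_odd k) = even S"
      "even (half_conv int_scaled_odd k) = even (fibbinary (k + 1))"
      using S half by (auto dest!: cong_dvd_iff)
    have 1: "even (int_scaled_even (k + 1)) = even (fibbinary (k + 1))"
      using arg_cong[OF int_scaled_even_Suc[of k], of even] even
      by (auto simp: *)
    have "even (int_scaled_odd (k + 1)) = even (fibbinary (k + 1))"
      using arg_cong[OF int_scaled_odd_Suc[of k], of even] even 1
      by (auto simp: *)
    with 1 Suc show ?thesis
      by (simp add: cong_iff_dvd_diff)
  qed
qed

lemma Com_eq_power_2_times:
  assumes "n \<ge> 1"
  obtains c where "Com n = 2 ^ (n div 2) * c" "odd c \<longleftrightarrow> no_adjacent_ones (n div 2)"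
proof (cases "even n")
  case True
  then obtain k where k: "n = 2 * k" by blast
  with assms have "odd (int_scaled_even k) \<longleftrightarrow> no_adjacent_ones k"
    using int_scaled_mod_2[of k] cong_dvd_iff[of "int_scaled_even k" "fibbinary k" 2]
    by (simp add: odd_fibbinary_iff)
  then show ?thesis
    using that[of "int_scaled_even k"] by (simp add: k Com_even)
next
  case False
  then obtain k where k: "n = 2 * k + 1" by (rule oddE)
  have "odd (int_scaled_odd k) \<longleftrightarrow> no_adjacent_ones k"
    using int_scaled_mod_2[of k] cong_dvd_iff[of "int_scaled_odd k" "fibbinary k" 2]
    by (simp add: odd_fibbinary_iff)
  then show ?thesis
    using that[of "int_scaled_odd k"] Com_odd[of k] by (simp add: k)
qed

theorem theorem11:
  fixes n m :: nat
  assumes "n \<ge> 1" and "m = n div 2"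
  shows "ordp 2 (Com n) \<ge> enat (nat \<lceil>(real n - 1) / 2\<rceil>) \<and>
    (ordp 2 (Com n) = enat (nat \<lceil>(real n - 1) / 2\<rceil>) \<longleftrightarrow> odd ((3 * m) choose m)) \<and>
    (odd ((3 * m) choose m) \<longleftrightarrow> \<not> (\<exists>i. bit m i \<and> bit m (Suc i)))"
proof -
  have ceil: "nat \<lceil>(real n - 1) / 2\<rceil> = m"
  proof (cases "even n")
    case True
    then have "real n = 2 * real m"
      using assms by auto
    then have "\<lceil>(real n - 1) / 2\<rceil> = int m"
      by (intro ceiling_unique) auto
    then show ?thesis by simp
  next
    case False
    then have "n = 2 * m + 1"
      using assms(2) by presburger
    then show ?thesis by simp
  qed
  obtain c where c: "Com n = 2 ^ m * c" "odd c \<longleftrightarrow> no_adjacent_ones m"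
    using Com_eq_power_2_times[OF assms(1)] assms(2) by blast
  have lower: "enat m \<le> ordp 2 (Com n)"
    using enat_le_ordp_iff[of 2 m "Com n"] c(1) by simp
  have "enat (m + 1) \<le> ordp 2 (Com n) \<longleftrightarrow> even c"
    using enat_le_ordp_iff[of 2 "m + 1" "Com n"] c(1) by simp
  then have "ordp 2 (Com n) = enat m \<longleftrightarrow> odd c"
    using lower by (cases "ordp 2 (Com n)") auto
  with lower c(2) show ?thesis
    unfolding ceil odd_choose_iff_no_adjacent_ones by (simp add: no_adjacent_ones_def)
qed

end
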